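(* For all positive integers $k,n,l,t$, we have \[ \operatorname{RT}(\mathcal{B};n,C_k,l,t)=\operatorname{RT}^{\sharp}(\mathcal{B};n,C_k,l,t), \] where $C_k$ is the $k$-element chain.
   Context: $B_n$ is the power set of $[n]=\{1,\dots,n\}$ ordered by inclusion; a subset $Q\subseteq B_n$ (possibly empty) is regarded as a poset with the induced order. A $t$-chain in a poset is a set of exactly $t$ distinct pairwise comparable elements, and $\mathcal{C}_t(Q)$ is the set of all $t$-chains of $Q$. The width $w(Q)$ is the size of a largest antichain of $Q$ (with $w(\emptyset)=0$). $C_k$ is the totally ordered set $a_1\le a_2\le\cdots\le a_k$ with $k$ distinct elements. An injection $f:P\to Q$ between posets is a weak embedding if $x\le y$ in $P$ implies $f(x)\le f(y)$ in $Q$, and a strong embedding if $x\le y$ in $P$ if and only if $f(x)\le f(y)$ in $Q$. $Q$ is weakly (resp. strongly) $P$-free if there is no weak (resp. strong) embedding of $P$ into $Q$. $\operatorname{RT}(\mathcal{B};n,P,l,t)$ (resp. $\operatorname{RT}^{\sharp}(\mathcal{B};n,P,l,t)$) is the maximum of $|\mathcal{C}_t(Q)|$ over all $Q\subseteq B_n$ such that $Q$ is weakly (resp. strongly) $P$-free and $w(Q)<l$. *)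

theory Defs
  imports "HOL-Library.FuncSet"
begin

text \<open>
  A poset is a set \<open>P :: 'a::order set\<close> with the order induced from its element type;
  for families of sets this order is inclusion.
\<close>

definition boolean_lattice :: "nat \<Rightarrow> nat set set" where
  "boolean_lattice n = Pow {1..n}"

definition chain_poset :: "nat \<Rightarrow> nat set" where
  "chain_poset k = {1..k}"

definition t_chains :: "nat \<Rightarrow> 'a::order set \<Rightarrow> 'a set set" where
  "t_chains t Q = {C. C \<subseteq> Q \<and> finite C \<and> card C = t \<and> Complete_Partial_Order.chain (\<le>) C}"

definition antichain :: "'a::order set \<Rightarrow> bool" where
  "antichain A \<longleftrightarrow> (\<forall>x\<in>A. \<forall>y\<in>A. x \<le> y \<longrightarrow> x = y)"

text \<open>Only meaningful for finite \<open>Q\<close>, as is the case for subsets of \<open>boolean_lattice n\<close>.\<close>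

definition width :: "'a::order set \<Rightarrow> nat" where
  "width Q = Max {card A |A. A \<subseteq> Q \<and> antichain A}"

definition weak_embedding :: "('a::order \<Rightarrow> 'b::order) \<Rightarrow> 'a set \<Rightarrow> 'b set \<Rightarrow> bool" where
  "weak_embedding f P Q \<longleftrightarrow>
     f \<in> P \<rightarrow> Q \<and> inj_on f P \<and> (\<forall>x\<in>P. \<forall>y\<in>P. x \<le> y \<longrightarrow> f x \<le> f y)"

definition strong_embedding :: "('a::order \<Rightarrow> 'b::order) \<Rightarrow> 'a set \<Rightarrow> 'b set \<Rightarrow> bool" where
  "strong_embedding f P Q \<longleftrightarrow>
     f \<in> P \<rightarrow> Q \<and> inj_on f P \<and> (\<forall>x\<in>P. \<forall>y\<in>P. x \<le> y \<longleftrightarrow> f x \<le> f y)"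

definition weakly_free :: "'a::order set \<Rightarrow> 'b::order set \<Rightarrow> bool" where
  "weakly_free P Q \<longleftrightarrow> (\<nexists>f. weak_embedding f P Q)"

definition strongly_free :: "'a::order set \<Rightarrow> 'b::order set \<Rightarrow> bool" where
  "strongly_free P Q \<longleftrightarrow> (\<nexists>f. strong_embedding f P Q)"

text \<open>
  The maxima below range over finite sets of numbers, which are nonempty whenever \<open>P\<close> is
  nonempty and \<open>l > 0\<close>, since then \<open>Q = {}\<close> is admissible.
\<close>

definition RT_weak :: "nat \<Rightarrow> 'a::order set \<Rightarrow> nat \<Rightarrow> nat \<Rightarrow> nat" where
  "RT_weak n P l t =
     Max {card (t_chains t Q) |Q. Q \<subseteq> boolean_lattice n \<and> weakly_free P Q \<and> width Q < l}"

definition RT_strong :: "nat \<Rightarrow> 'a::order set \<Rightarrow> nat \<Rightarrow> nat \<Rightarrow> nat" where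
  "RT_strong n P l t =
     Max {card (t_chains t Q) |Q. Q \<subseteq> boolean_lattice n \<and> strongly_free P Q \<and> width Q < l}"

end

theory Submission
  imports Defs
begin

text \<open>
  Over a totally ordered source the two notions of embedding coincide, so a chain is weakly
  avoided exactly when it is strongly avoided, and both maxima range over the same families.
\<close>

text \<open>
  A weak embedding reflects the order here: if \<open>f x \<le> f y\<close> but not \<open>x \<le> y\<close>, then totality
  gives \<open>y \<le> x\<close>, hence \<open>f y \<le> f x\<close> by monotonicity, so \<open>f x = f y\<close> by antisymmetry, and
  injectivity forces \<open>x = y\<close>.
\<close>

lemma weak_embedding_iff_strong_embedding_if_total:
  assumes total: "\<And>x y. x \<in> P \<Longrightarrow> y \<in> P \<Longrightarrow> x \<le> y \<or> y \<le> x"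
  shows "weak_embedding f P Q \<longleftrightarrow> strong_embedding f P Q"
proof
  assume weak: "weak_embedding f P Q"
  have inj: "inj_on f P" and into: "f \<in> P \<rightarrow> Q"
    using weak by (simp_all add: weak_embedding_def)
  have mono: "f x \<le> f y" if "x \<in> P" "y \<in> P" "x \<le> y" for x y
    using weak that by (simp add: weak_embedding_def)
  have reflect: "x \<le> y" if "x \<in> P" "y \<in> P" "f x \<le> f y" for x y
  proof (rule disjE[OF total[OF that(1,2)]])
    assume "y \<le> x"
    then have "f x = f y"
      using mono[OF that(2,1)] that(3) by simp
    then show "x \<le> y"
      using inj_onD[OF inj _ that(1,2)] by simp
  qed
  have "x \<le> y \<longleftrightarrow> f x \<le> f y" if "x \<in> P" "y \<in> P" for x y
    using mono[OF that] reflect[OF that] by (rule iffI)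
  then show "strong_embedding f P Q"
    using inj into by (simp add: strong_embedding_def)
next
  assume "strong_embedding f P Q"
  then show "weak_embedding f P Q"
    by (simp add: weak_embedding_def strong_embedding_def)
qed

theorem theorem3p4:
  fixes k n l t :: nat
  assumes "k > 0" and "n > 0" and "l > 0" and "t > 0"
  shows "RT_weak n (chain_poset k) l t = RT_strong n (chain_poset k) l t"
proof -
  have "weakly_free (chain_poset k) Q \<longleftrightarrow> strongly_free (chain_poset k) Q"
    for Q :: "nat set set"
    unfolding weakly_free_def strongly_free_def
    by (simp only: weak_embedding_iff_strong_embedding_if_total[OF linear])
  then show ?thesis
    unfolding RT_weak_def RT_strong_def by simp
qed

end
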